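(* Let $R$ be a ring. Then: (1) $R$ is a $2$-primal ring if and only if $J^{\#}(R[x])=Nil_*(R)[x]$; (2) $R$ is a reduced ring if and only if $J^{\#}(R[x])=\{0\}$.
   Context: All rings are associative with identity. For a ring $A$ with Jacobson radical $J(A)$, define $J^{\#}(A)=\{z\in A : z^n\in J(A)\text{ for some } n\ge 1\}$. $Nil(R)$ is the set of nilpotent elements of $R$ and $Nil_*(R)$ is the prime radical of $R$ (intersection of all prime ideals); $R$ is $2$-primal if $Nil(R)=Nil_*(R)$, and reduced if it has no nonzero nilpotent elements. $R[x]$ is the ordinary polynomial ring (with $x$ central), and $Nil_*(R)[x]$ is the set of polynomials all of whose coefficients lie in $Nil_*(R)$. *)

theory Defs
  imports "HOL-Algebra.UnivPoly" "HOL-Algebra.Ideal_Product"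
begin

(* All rings are those of the locale ring: associative with identity, not necessarily
   commutative, and possibly the zero ring.  primeideal is tied to cring, and there are
   no one-sided ideals in HOL-Algebra, so both are set up here for arbitrary rings. *)

locale left_ideal = additive_subgroup I R + ring R for I and R (structure) +
  assumes I_l_closed: "\<lbrakk>a \<in> I; x \<in> carrier R\<rbrakk> \<Longrightarrow> x \<otimes> a \<in> I"

locale maximal_left_ideal = left_ideal +
  assumes I_notcarr: "carrier R \<noteq> I"
    and I_maximal: "\<lbrakk>left_ideal J R; I \<subseteq> J; J \<subseteq> carrier R\<rbrakk> \<Longrightarrow> J = I \<or> J = carrier R"

locale nc_prime_ideal = ideal +
  assumes I_notcarr: "carrier R \<noteq> I"
    and I_prime: "\<lbrakk>ideal A R; ideal B R; ideal_prod R A B \<subseteq> I\<rbrakk> \<Longrightarrow> A \<subseteq> I \<or> B \<subseteq> I"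

(* In both radicals the empty intersection is the whole ring; this only matters for the
   zero ring. *)

definition jacobson_radical :: "('a, 'b) ring_scheme \<Rightarrow> 'a set"
  where "jacobson_radical R = {a \<in> carrier R. \<forall>I. maximal_left_ideal I R \<longrightarrow> a \<in> I}"

definition prime_radical :: "('a, 'b) ring_scheme \<Rightarrow> 'a set"
  where "prime_radical R = {a \<in> carrier R. \<forall>P. nc_prime_ideal P R \<longrightarrow> a \<in> P}"

definition J_sharp :: "('a, 'b) ring_scheme \<Rightarrow> 'a set"
  where "J_sharp R = {z \<in> carrier R. \<exists>n::nat. n \<ge> 1 \<and> z [^]\<^bsub>R\<^esub> n \<in> jacobson_radical R}"

definition nilpotents :: "('a, 'b) ring_scheme \<Rightarrow> 'a set"
  where "nilpotents R = {a \<in> carrier R. \<exists>n::nat. n \<ge> 1 \<and> a [^]\<^bsub>R\<^esub> n = \<zero>\<^bsub>R\<^esub>}"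

definition two_primal :: "('a, 'b) ring_scheme \<Rightarrow> bool"
  where "two_primal R \<longleftrightarrow> nilpotents R = prime_radical R"

definition reduced_ring :: "('a, 'b) ring_scheme \<Rightarrow> bool"
  where "reduced_ring R \<longleftrightarrow> (\<forall>a \<in> nilpotents R. a = \<zero>\<^bsub>R\<^esub>)"

definition polys_over :: "('a, 'b) ring_scheme \<Rightarrow> 'a set \<Rightarrow> (nat \<Rightarrow> 'a) set"
  where "polys_over R S = {p \<in> carrier (UP R). \<forall>n. coeff (UP R) p n \<in> S}"

end

theory Submission
  imports Defs
begin

text \<open>
  Let \<open>N\<close> be the prime radical of \<open>R\<close>. For a maximal left ideal \<open>M\<close> of \<open>R[x]\<close>, the annihilator of
  \<open>R[x] / M\<close> meets \<open>R\<close> in a prime ideal, hence \<open>N[x] \<subseteq> J(R[x])\<close>. Conversely, if \<open>K\<close> is any ideal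
  with \<open>R / K\<close> reduced and \<open>g \<in> J(R[x])\<close>, then \<open>1 - x g\<close> is left invertible; modulo \<open>K\<close> such a
  polynomial is constant, so \<open>g \<in> K[x]\<close>, and as \<open>R[x] / K[x]\<close> is reduced too, the same holds for
  \<open>g \<in> J\<^sup>#(R[x])\<close>. For the reverse implications, constant nilpotent polynomials lie in
  \<open>J\<^sup>#(R[x])\<close>, and \<open>N\<close> is nil because a constant \<open>a \<in> J(R[x])\<close> is nilpotent.
\<close>

section \<open>Left ideals and the Jacobson radical\<close>

text \<open>Closure under negation comes from left multiplication by
  \<open>\<ominus> \<one>\<close>.\<close>

lemma left_idealI:
  fixes R (structure)
  assumes "ring R" and "I \<subseteq> carrier R" and "\<zero>\<^bsub>R\<^esub> \<in> I"
    and add: "\<And>a b. \<lbrakk>a \<in> I; b \<in> I\<rbrakk> \<Longrightarrow> a \<oplus>\<^bsub>R\<^esub> b \<in> I"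
    and mult: "\<And>a x. \<lbrakk>a \<in> I; x \<in> carrier R\<rbrakk> \<Longrightarrow> x \<otimes>\<^bsub>R\<^esub> a \<in> I"
  shows "left_ideal I R"
proof -
  interpret ring R by fact
  have "\<ominus> a \<in> I" if "a \<in> I" for a
    using mult[OF that, of "\<ominus> \<one>"] that \<open>I \<subseteq> carrier R\<close> l_minus by auto
  then have "subgroup I (add_monoid R)"
    using assms add.subgroupI[of I] by (auto simp: a_inv_def)
  then show ?thesis
    by (intro left_ideal.intro left_ideal_axioms.intro additive_subgroup.intro ring_axioms mult)
qed

lemma ideal_if_left_ideal:
  assumes "left_ideal I R" and "\<And>a x. \<lbrakk>a \<in> I; x \<in> carrier R\<rbrakk> \<Longrightarrow> a \<otimes>\<^bsub>R\<^esub> x \<in> I"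
  shows "ideal I R"
proof -
  interpret left_ideal I R by fact
  show ?thesis
    by (intro idealI a_subgroup I_l_closed ring_axioms assms(2))
qed

context ring
begin

lemma ideal_left_ideal: "ideal I R \<Longrightarrow> left_ideal I R"
  by (meson ideal.I_l_closed ideal.axioms left_ideal.intro left_ideal_axioms.intro)

lemma set_add_left_ideal:
  assumes "left_ideal I R" and "left_ideal J R"
  shows "left_ideal (I <+>\<^bsub>R\<^esub> J) R"
proof -
  interpret I: left_ideal I R by fact
  interpret J: left_ideal J R by fact
  show ?thesis
  proof (intro left_ideal.intro left_ideal_axioms.intro ring_axioms)
    show "additive_subgroup (I <+>\<^bsub>R\<^esub> J) R"
      by (intro add_additive_subgroups I.is_additive_subgroup J.is_additive_subgroup)
  next
    fix a x assume "a \<in> I <+>\<^bsub>R\<^esub> J" and x: "x \<in> carrier R"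
    then obtain i j where "i \<in> I" "j \<in> J" "a = i \<oplus> j"
      by (auto simp: set_add_def')
    then have "x \<otimes> a = x \<otimes> i \<oplus> x \<otimes> j"
      using x by (simp add: r_distr)
    then show "x \<otimes> a \<in> I <+>\<^bsub>R\<^esub> J"
      using I.I_l_closed[OF \<open>i \<in> I\<close> x] J.I_l_closed[OF \<open>j \<in> J\<close> x] by (auto simp: set_add_def')
  qed
qed

text \<open>Zorn's lemma on the left ideals that contain \<open>L\<close> and avoid
  \<open>\<one>\<close>: avoiding \<open>\<one>\<close> is the same as being proper, and it survives
  unions of chains.\<close>

lemma exists_maximal_left_ideal:
  assumes "left_ideal L R" and "\<one> \<notin> L"
  obtains M where "maximal_left_ideal M R" and "L \<subseteq> M"
proof -
  define F where "F = {I. left_ideal I R \<and> L \<subseteq> I \<and> \<one> \<notin> I}"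
  have "\<exists>M\<in>F. \<forall>X\<in>F. M \<subseteq> X \<longrightarrow> X = M"
  proof (rule subset_Zorn_nonempty)
    show "F \<noteq> {}"
      using assms by (auto simp: F_def)
  next
    fix C assume "C \<noteq> {}" and chain: "subset.chain F C"
    then have C: "left_ideal I R" "L \<subseteq> I" "\<one> \<notin> I" if "I \<in> C" for I
      using that by (auto simp: F_def subset_chain_def)
    have sub: "additive_subgroup I R" if "I \<in> C" for I
      using C(1)[OF that] by (rule left_ideal.axioms)
    have "left_ideal (\<Union>C) R"
    proof (rule left_idealI[OF ring_axioms])
      show "\<Union>C \<subseteq> carrier R"
        using additive_subgroup.a_subset[OF sub] by blast
      show "\<zero> \<in> \<Union>C"
        using \<open>C \<noteq> {}\<close> additive_subgroup.zero_closed[OF sub] by blast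
      show "a \<oplus> b \<in> \<Union>C" if "a \<in> \<Union>C" "b \<in> \<Union>C" for a b
      proof -
        obtain I J where "I \<in> C" "a \<in> I" "J \<in> C" "b \<in> J"
          using \<open>a \<in> \<Union>C\<close> \<open>b \<in> \<Union>C\<close> by auto
        moreover have "I \<subseteq> J \<or> J \<subseteq> I"
          using chain \<open>I \<in> C\<close> \<open>J \<in> C\<close> by (auto simp: subset_chain_def)
        ultimately show ?thesis
          using additive_subgroup.a_closed[OF sub] by blast
      qed
      show "x \<otimes> a \<in> \<Union>C" if "a \<in> \<Union>C" "x \<in> carrier R" for a x
        using that left_ideal.I_l_closed[OF C(1)] by blast
    qed
    then show "\<Union>C \<in> F"
      using C \<open>C \<noteq> {}\<close> unfolding F_def by blast
  qed
  then obtain M where "M \<in> F" and max: "\<And>X. \<lbrakk>X \<in> F; M \<subseteq> X\<rbrakk> \<Longrightarrow> X = M"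
    by blast
  then interpret M: left_ideal M R
    by (simp add: F_def)
  have "maximal_left_ideal M R"
  proof
    show "carrier R \<noteq> M"
      using \<open>M \<in> F\<close> by (auto simp: F_def)
  next
    fix J assume J: "left_ideal J R" "M \<subseteq> J" "J \<subseteq> carrier R"
    show "J = M \<or> J = carrier R"
    proof (cases "\<one> \<in> J")
      case True
      then show ?thesis
        using left_ideal.I_l_closed[OF J(1) True] J(3) by fastforce
    next
      case False
      then show ?thesis
        using J max[of J] \<open>M \<in> F\<close> by (auto simp: F_def)
    qed
  qed
  then show thesis
    using that \<open>M \<in> F\<close> by (auto simp: F_def)
qed

text \<open>If the left ideal generated by \<open>\<one> \<ominus> s \<otimes> a\<close> were
  proper, it would lie in a maximal left ideal. That ideal also contains
  \<open>s \<otimes> a\<close>, hence \<open>\<one>\<close>, which is absurd.\<close>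

lemma jacobson_radical_left_inverse:
  assumes "a \<in> jacobson_radical R" and s: "s \<in> carrier R"
  obtains h where "h \<in> carrier R" and "h \<otimes> (\<one> \<ominus> s \<otimes> a) = \<one>"
proof -
  have a: "a \<in> carrier R"
    using assms by (simp add: jacobson_radical_def)
  define u where "u = \<one> \<ominus> s \<otimes> a"
  have u: "u \<in> carrier R"
    using a s by (simp add: u_def)
  define L where "L = (\<lambda>h. h \<otimes> u) ` carrier R"
  have L: "left_ideal L R"
  proof (rule left_idealI[OF ring_axioms])
    show "L \<subseteq> carrier R"
      using u by (auto simp: L_def)
    show "\<zero> \<in> L"
      unfolding L_def using l_null[OF u] by (metis image_eqI zero_closed)
    show "x \<oplus> y \<in> L" if "x \<in> L" "y \<in> L" for x y
      using that u l_distr[OF _ _ u, symmetric] by (auto simp: L_def)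
    show "x \<otimes> y \<in> L" if "y \<in> L" "x \<in> carrier R" for x y
      using that u m_assoc[OF _ _ u, symmetric] by (auto simp: L_def)
  qed
  have "\<one> \<in> L"
  proof (rule ccontr)
    assume "\<one> \<notin> L"
    with L obtain M where M: "maximal_left_ideal M R" and "L \<subseteq> M"
      by (rule exists_maximal_left_ideal)
    interpret maximal_left_ideal M R by fact
    have "u \<in> L"
      unfolding L_def using l_one[OF u] by (metis image_eqI one_closed)
    then have "u \<in> M"
      using \<open>L \<subseteq> M\<close> by blast
    moreover have "s \<otimes> a \<in> M"
      using assms M by (auto simp: jacobson_radical_def intro: I_l_closed)
    ultimately have "u \<oplus> s \<otimes> a \<in> M"
      by (rule a_closed)
    moreover have "u \<oplus> s \<otimes> a = \<one>"
      using a s unfolding u_def by algebra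
    ultimately have "\<one> \<in> M"
      by simp
    then have "carrier R = M"
      using I_l_closed[of \<one>] a_subset by fastforce
    then show False
      using I_notcarr by simp
  qed
  then show thesis
    using that by (auto simp: L_def u_def)
qed

lemma zero_in_jacobson_radical: "\<zero> \<in> jacobson_radical R"
  unfolding jacobson_radical_def maximal_left_ideal_def left_ideal_def
  by (auto intro: additive_subgroup.zero_closed)

lemma nilpotents_subset_J_sharp: "nilpotents R \<subseteq> J_sharp R"
  using zero_in_jacobson_radical by (auto simp: nilpotents_def J_sharp_def)

lemma jacobson_radical_subset_J_sharp: "jacobson_radical R \<subseteq> J_sharp R"
  unfolding J_sharp_def by (auto simp: jacobson_radical_def intro!: exI[of _ "1::nat"])

lemma prime_radical_ideal: "ideal (prime_radical R) R"
proof (rule ideal_if_left_ideal[OF left_idealI[OF ring_axioms]])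
  show "\<zero> \<in> prime_radical R"
    by (auto simp: prime_radical_def nc_prime_ideal_def ideal_def additive_subgroup.zero_closed)
  show "a \<oplus> b \<in> prime_radical R" if "a \<in> prime_radical R" "b \<in> prime_radical R" for a b
    using that
    by (auto simp: prime_radical_def nc_prime_ideal_def ideal_def intro: additive_subgroup.a_closed)
  show "x \<otimes> a \<in> prime_radical R" "a \<otimes> x \<in> prime_radical R"
    if "a \<in> prime_radical R" "x \<in> carrier R" for a x
    using that
    by (auto simp: prime_radical_def nc_prime_ideal_def intro: ideal.I_l_closed ideal.I_r_closed)
qed (auto simp: prime_radical_def)

end

section \<open>Completely semiprime ideals\<close>

context ideal
begin

lemma finsum_mem:
  assumes "finite A" and "\<And>i. i \<in> A \<Longrightarrow> f i \<in> I"
  shows "(\<Oplus>i\<in>A. f i) \<in> I"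
  using assms by (induction A) (auto simp: Pi_def)

text \<open>Isolates one term of a convolution sum modulo \<open>I\<close>; it is applied to
  coefficients of products of polynomials.\<close>

lemma finsum_mem_imp_term_mem:
  assumes "(\<Oplus>i\<in>A. f i) \<in> I" and "finite A" and "j \<in> A" and "f j \<in> carrier R"
    and other: "\<And>i. \<lbrakk>i \<in> A; i \<noteq> j\<rbrakk> \<Longrightarrow> f i \<in> I"
  shows "f j \<in> I"
proof -
  let ?t = "\<Oplus>i\<in>A - {j}. f i"
  have t: "?t \<in> I"
    using assms by (intro finsum_mem) auto
  have "(\<Oplus>i\<in>insert j (A - {j}). f i) = f j \<oplus> ?t"
    using assms by (intro finsum_insert) auto
  then have "f j \<oplus> ?t \<in> I"
    using assms by (simp add: insert_absorb)
  moreover have "f j = (f j \<oplus> ?t) \<oplus> \<ominus> ?t"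
    using assms t Icarr[OF t] by algebra
  ultimately show ?thesis
    using additive_subgroup.a_closed[OF is_additive_subgroup _ additive_subgroup.a_inv_closed[OF is_additive_subgroup t]] by metis
qed

end

text \<open>Says that \<open>R / I\<close> is reduced, phrased with elements so that no quotient
  ring is formed.\<close>

locale completely_semiprime_ideal = ideal +
  assumes square_mem_imp_mem: "\<lbrakk>a \<in> carrier R; a \<otimes> a \<in> I\<rbrakk> \<Longrightarrow> a \<in> I"
begin

lemma pow_mem_imp_mem:
  assumes "a \<in> carrier R" and "n \<ge> 1" and "a [^] (n::nat) \<in> I"
  shows "a \<in> I"
  using assms(2,3)
proof (induction n)
  case (Suc n)
  show ?case
  proof (cases n)
    case 0
    then show ?thesis
      using Suc assms by simp
  next
    case (Suc m)
    \<comment> \<open>As \<open>n = Suc m\<close>, the exponents add up to \<open>2 * n\<close>: the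
      square of \<open>a [^] n\<close> lies in \<open>I\<close>, and the exponent drops by
      one.\<close>
    have "a [^] Suc n \<otimes> a [^] m \<in> I"
      using Suc.prems assms by (intro I_r_closed) auto
    then have "a [^] n \<otimes> a [^] n \<in> I"
      using assms by (metis (no_types, lifting) Suc add_Suc add_Suc_right nat_pow_mult)
    then show ?thesis
      using Suc assms Suc.IH square_mem_imp_mem[of "a [^] n"] by simp
  qed
qed simp

end

text \<open>Puts the reduced case in the same form as the 2-primal one, with the zero ideal in place
  of the prime radical.\<close>

lemma (in ring) reduced_ring_iff:
  "reduced_ring R \<longleftrightarrow> completely_semiprime_ideal {\<zero>} R"
proof
  assume red: "reduced_ring R"
  show "completely_semiprime_ideal {\<zero>} R"
  proof (intro completely_semiprime_ideal.intro completely_semiprime_ideal_axioms.intro zeroideal)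
    fix a assume "a \<in> carrier R" "a \<otimes> a \<in> {\<zero>}"
    then have "a \<in> nilpotents R"
      by (auto simp: nilpotents_def numeral_2_eq_2 intro!: exI[of _ "2::nat"])
    then show "a \<in> {\<zero>}"
      using red by (simp add: reduced_ring_def)
  qed
next
  assume "completely_semiprime_ideal {\<zero>} R"
  then interpret completely_semiprime_ideal "{\<zero>}" R .
  show "reduced_ring R"
    using pow_mem_imp_mem by (auto simp: reduced_ring_def nilpotents_def)
qed

lemma (in ring) two_primal_imp_completely_semiprime:
  assumes "two_primal R"
  shows "completely_semiprime_ideal (prime_radical R) R"
proof (intro completely_semiprime_ideal.intro completely_semiprime_ideal_axioms.intro
    prime_radical_ideal)
  fix a assume a: "a \<in> carrier R" and "a \<otimes> a \<in> prime_radical R"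
  then obtain n :: nat where "n \<ge> 1" "(a \<otimes> a) [^] n = \<zero>"
    using assms by (auto simp: two_primal_def nilpotents_def)
  then have "a [^] (2 * n) = \<zero>"
    using a nat_pow_pow[of a 2 n] by (simp add: numeral_2_eq_2)
  then show "a \<in> prime_radical R"
    using assms a \<open>n \<ge> 1\<close> unfolding two_primal_def nilpotents_def
    by (metis (mono_tags, lifting) le_add1 mem_Collect_eq mult_2 order_trans)
qed

section \<open>Radicals of polynomial rings\<close>

context UP_ring
begin

section \<open>Coefficient ideals and left invertible polynomials\<close>

lemma polys_over_iff: "p \<in> polys_over R S \<longleftrightarrow> p \<in> carrier P \<and> (\<forall>n. coeff P p n \<in> S)"
  by (simp add: polys_over_def P_def)

lemma polys_over_ideal:
  assumes "ideal I R"
  shows "ideal (polys_over R I) P"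
proof -
  interpret I: ideal I R by fact
  show ?thesis
  proof (rule ideal_if_left_ideal[OF left_idealI[OF UP_ring]])
    show "a \<otimes>\<^bsub>P\<^esub> x \<in> polys_over R I" "x \<otimes>\<^bsub>P\<^esub> a \<in> polys_over R I"
      if "a \<in> polys_over R I" "x \<in> carrier P" for a x
      using that by (auto simp: polys_over_iff intro!: I.finsum_mem intro: I.I_l_closed I.I_r_closed)
  qed (auto simp: polys_over_iff)
qed

lemma polys_over_completely_semiprime:
  assumes "completely_semiprime_ideal N R"
  shows "completely_semiprime_ideal (polys_over R N) P"
proof -
  interpret N: completely_semiprime_ideal N R by fact
  show ?thesis
  proof (rule completely_semiprime_ideal.intro[OF polys_over_ideal[OF N.is_ideal]],
      rule completely_semiprime_ideal_axioms.intro)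
    fix f assume f: "f \<in> carrier P" and ff: "f \<otimes>\<^bsub>P\<^esub> f \<in> polys_over R N"
    have "coeff P f k \<in> N" for k
    proof (induction k rule: less_induct)
      case (less k)
      let ?t = "\<lambda>i. coeff P f i \<otimes> coeff P f (2 * k - i)"
      have "coeff P (f \<otimes>\<^bsub>P\<^esub> f) (2 * k) \<in> N"
        using ff by (simp only: polys_over_iff)
      then have "(\<Oplus>i\<in>{..2 * k}. ?t i) \<in> N"
        by (simp only: coeff_mult[OF f f])
      then have "?t k \<in> N"
      proof (rule N.finsum_mem_imp_term_mem)
        fix i assume "i \<in> {..2 * k}" "i \<noteq> k"
        then have "i < k \<or> 2 * k - i < k"
          by auto
        then show "?t i \<in> N"
          using less f by (auto intro: N.I_l_closed N.I_r_closed)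
      qed (use f in auto)
      then show ?case
        using f N.square_mem_imp_mem[of "coeff P f k"] by simp
    qed
    then show "f \<in> polys_over R N"
      using f by (simp add: polys_over_iff)
  qed
qed

text \<open>
  Modulo \<open>N\<close>, the leading coefficient of \<open>u\<close> annihilates every coefficient of \<open>h\<close>, from the
  top down, since \<open>a b a = 0\<close> implies \<open>a b = 0\<close> in a reduced ring.
\<close>

lemma coeff_left_invertible_mem:
  assumes "completely_semiprime_ideal N R" and h: "h \<in> carrier P" and u: "u \<in> carrier P"
    and hu: "h \<otimes>\<^bsub>P\<^esub> u = \<one>\<^bsub>P\<^esub>" and "k \<ge> 1"
  shows "coeff P u k \<in> N"
proof -
  interpret N: completely_semiprime_ideal N R by fact
  let ?h = "coeff P h" and ?u = "coeff P u"
  have hu_coeff: "(\<Oplus>i\<in>{..n}. ?h i \<otimes> ?u (n - i)) = (if n = 0 then \<one> else \<zero>)" for n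
    using coeff_mult[OF h u, of n] coeff_one[of n] hu by simp
  show ?thesis
    using \<open>k \<ge> 1\<close>
  \<comment> \<open>Downward induction on \<open>k\<close>, started by the vanishing of the
    coefficients above the degree. The inner induction on \<open>i\<close> runs downward in the same
    way.\<close>
  proof (induction k rule: measure_induct_rule[of "\<lambda>k. deg R u - k"])
    case (less k)
    have higher: "?u j \<in> N" if "j > k" for j
    proof (cases "j > deg R u")
      case True
      then show ?thesis
        using u by (simp add: deg_aboveD)
    next
      case False
      then show ?thesis
        using that less by auto
    qed
    have "?u k \<otimes> ?h i \<in> N" for i
    proof (induction i rule: measure_induct_rule[of "\<lambda>i. deg R h - i"])
      case (less i)
      have IH: "?u k \<otimes> ?h j \<in> N" if "j > i" for j
      proof (cases "j > deg R h")
        case True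
        then show ?thesis
          using h u by (simp add: deg_aboveD)
      next
        case False
        then show ?thesis
          using that less by auto
      qed
      let ?t = "\<lambda>j. ?u k \<otimes> (?h j \<otimes> ?u (i + k - j))"
      \<comment> \<open>The coefficient of \<open>h u\<close> at \<open>i + k\<close> vanishes, as
        \<open>k \<ge> 1\<close>. After left multiplication by \<open>?u k\<close>, terms with
        \<open>j < i\<close> contain a coefficient of \<open>u\<close> above \<open>k\<close>, and
        terms with \<open>j > i\<close> contain \<open>?u k \<otimes> ?h j\<close>; only
        \<open>j = i\<close> remains.\<close>
      have "(\<Oplus>j\<in>{..i + k}. ?t j) = ?u k \<otimes> (\<Oplus>j\<in>{..i + k}. ?h j \<otimes> ?u (i + k - j))"
        using h u by (intro R.finsum_rdistr[symmetric]) auto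
      also have "\<dots> = \<zero>"
        using \<open>k \<ge> 1\<close> u unfolding hu_coeff by simp
      finally have "(\<Oplus>j\<in>{..i + k}. ?t j) \<in> N"
        by simp
      then have "?t i \<in> N"
      proof (rule N.finsum_mem_imp_term_mem)
        fix j assume j: "j \<in> {..i + k}" "j \<noteq> i"
        show "?t j \<in> N"
        proof (cases "j < i")
          case True
          then show ?thesis
            using h u by (intro N.I_l_closed higher) auto
        next
          case False
          then have "?u k \<otimes> ?h j \<otimes> ?u (i + k - j) \<in> N"
            using h u j by (intro N.I_r_closed IH) auto
          then show ?thesis
            using h u by (simp add: R.m_assoc)
        qed
      qed (use h u in auto)
      \<comment> \<open>Right multiplication by \<open>?h i\<close> produces the square of
        \<open>?u k \<otimes> ?h i\<close>.\<close>
      then have "?u k \<otimes> (?h i \<otimes> ?u k) \<otimes> ?h i \<in> N"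
        using h u N.I_r_closed by simp
      then show ?case
        using h u N.square_mem_imp_mem[of "?u k \<otimes> ?h i"] by (simp add: R.m_assoc)
    qed
    \<comment> \<open>The constant coefficients satisfy \<open>?h 0 \<otimes> ?u 0 = \<one>\<close>,
      so the case \<open>i = 0\<close> gives \<open>?u k\<close> itself.\<close>
    then have "?u k \<otimes> ?h 0 \<otimes> ?u 0 \<in> N"
      using h u by (intro N.I_r_closed[of "?u k \<otimes> ?h 0"]) auto
    moreover have "?h 0 \<otimes> ?u 0 = \<one>"
      using hu_coeff[of 0] h u by simp
    ultimately show ?case
      using h u by (simp add: R.m_assoc)
  qed
qed

lemma coeff_X_mult:
  assumes "p \<in> carrier P"
  shows "coeff P (monom P \<one> 1 \<otimes>\<^bsub>P\<^esub> p) k = (case k of 0 \<Rightarrow> \<zero> | Suc m \<Rightarrow> coeff P p m)"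
proof (cases k)
  case 0
  then show ?thesis
    using assms by simp
next
  case (Suc m)
  have "coeff P (monom P \<one> 1 \<otimes>\<^bsub>P\<^esub> p) k = (\<Oplus>i\<in>{..k}. if 1 = i then coeff P p (k - i) else \<zero>)"
    using assms by (auto intro!: R.finsum_cong')
  also have "\<dots> = coeff P p (k - 1)"
    using assms Suc by (intro R.finsum_singleton) auto
  finally show ?thesis
    using Suc by simp
qed

text \<open>The factor \<open>x\<close> in \<open>1 - x g\<close> shifts all coefficients of
  \<open>g\<close> into positive degrees, where \<open>1\<close> contributes nothing and left
  invertibility forces membership in \<open>N\<close>.\<close>

lemma jacobson_radical_subset_polys_over:
  assumes "completely_semiprime_ideal N R"
  shows "jacobson_radical P \<subseteq> polys_over R N"
proof
  interpret N: completely_semiprime_ideal N R by fact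
  fix g assume g: "g \<in> jacobson_radical P"
  then have gP: "g \<in> carrier P"
    by (simp add: jacobson_radical_def)
  define u where "u = \<one>\<^bsub>P\<^esub> \<ominus>\<^bsub>P\<^esub> monom P \<one> 1 \<otimes>\<^bsub>P\<^esub> g"
  have u: "u \<in> carrier P"
    using gP by (simp add: u_def)
  obtain h where h: "h \<in> carrier P" "h \<otimes>\<^bsub>P\<^esub> u = \<one>\<^bsub>P\<^esub>"
    using P.jacobson_radical_left_inverse[OF g, of "monom P \<one> 1"] by (auto simp: u_def)
  have "coeff P g m \<in> N" for m
  proof -
    have "coeff P u (Suc m) = \<ominus> coeff P g m"
      using gP by (simp add: u_def P.minus_eq coeff_X_mult del: coeff_mult One_nat_def)
    moreover have "coeff P u (Suc m) \<in> N"
      using assms h u by (intro coeff_left_invertible_mem) auto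
    ultimately show ?thesis
      using gP by (metis N.a_inv_closed R.minus_minus coeff_closed)
  qed
  then show "g \<in> polys_over R N"
    using gP by (simp add: polys_over_iff)
qed

lemma J_sharp_subset_polys_over:
  assumes "completely_semiprime_ideal N R"
  shows "J_sharp P \<subseteq> polys_over R N"
proof
  interpret completely_semiprime_ideal "polys_over R N" P
    using assms by (rule polys_over_completely_semiprime)
  fix f assume "f \<in> J_sharp P"
  then show "f \<in> polys_over R N"
    using jacobson_radical_subset_polys_over[OF assms] pow_mem_imp_mem
    by (auto simp: J_sharp_def)
qed

text \<open>
  If \<open>h (1 - a x) = 1\<close> then \<open>h\<close> is the geometric series in \<open>a x\<close>, so some power of \<open>a\<close> vanishes.
\<close>

lemma const_in_jacobson_radical_imp_nilpotent:
  assumes a: "a \<in> carrier R" and J: "monom P a 0 \<in> jacobson_radical P"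
  shows "a \<in> nilpotents R"
proof -
  have "monom P \<one> 1 \<otimes>\<^bsub>P\<^esub> monom P a 0 = monom P a 1"
    using a monom_mult[of \<one> a 1 0] by simp
  then obtain h where h: "h \<in> carrier P" and hu: "h \<otimes>\<^bsub>P\<^esub> (\<one>\<^bsub>P\<^esub> \<ominus>\<^bsub>P\<^esub> monom P a 1) = \<one>\<^bsub>P\<^esub>"
    using P.jacobson_radical_left_inverse[OF J, of "monom P \<one> 1"] by auto
  have "h = h \<otimes>\<^bsub>P\<^esub> (\<one>\<^bsub>P\<^esub> \<ominus>\<^bsub>P\<^esub> monom P a 1) \<oplus>\<^bsub>P\<^esub> h \<otimes>\<^bsub>P\<^esub> monom P a 1"
  proof -
    have "(\<one>\<^bsub>P\<^esub> \<ominus>\<^bsub>P\<^esub> monom P a 1) \<oplus>\<^bsub>P\<^esub> monom P a 1 = \<one>\<^bsub>P\<^esub>"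
      using monom_closed[OF a, of 1] by (simp add: P.minus_eq P.a_assoc P.l_neg del: One_nat_def)
    then show ?thesis
      using h monom_closed[OF a, of 1]
      by (metis P.minus_closed P.r_distr P.r_one UP_one_closed)
  qed
  \<comment> \<open>Comparing coefficients, \<open>h\<close> starts with \<open>\<one>\<close> and
    each further coefficient is the previous one times \<open>a\<close>.\<close>
  then have rec: "h = \<one>\<^bsub>P\<^esub> \<oplus>\<^bsub>P\<^esub> h \<otimes>\<^bsub>P\<^esub> monom P a 1"
    by (simp only: hu)
  have coeff_rec: "coeff P (h \<otimes>\<^bsub>P\<^esub> monom P a 1) k = (case k of 0 \<Rightarrow> \<zero> | Suc m \<Rightarrow> coeff P h m \<otimes> a)" for k
  proof (cases k)
    case 0
    then show ?thesis
      using h a by simp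
  next
    case (Suc m)
    have "coeff P (h \<otimes>\<^bsub>P\<^esub> monom P a 1) k = (\<Oplus>i\<in>{..k}. if m = i then coeff P h i \<otimes> a else \<zero>)"
      using h a Suc by (auto intro!: R.finsum_cong')
    also have "\<dots> = coeff P h m \<otimes> a"
      using h a Suc by (intro R.finsum_singleton) auto
    finally show ?thesis
      using Suc by simp
  qed
  have step: "coeff P h k = coeff P \<one>\<^bsub>P\<^esub> k \<oplus> coeff P (h \<otimes>\<^bsub>P\<^esub> monom P a 1) k" for k
    by (subst rec) (use h a in \<open>simp del: coeff_mult coeff_one\<close>)
  have "coeff P h k = a [^] k" for k
  proof (induction k)
    case 0
    then show ?case
      using step[of 0] a h coeff_rec[of 0] by (simp del: coeff_mult)
  next
    case (Suc k)
    then show ?case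
      using step[of "Suc k"] a h coeff_rec[of "Suc k"] by (simp del: coeff_mult)
  qed
  \<comment> \<open>This is the first coefficient of \<open>h\<close> above its degree.\<close>
  then have "a [^] Suc (deg R h) = \<zero>"
    using deg_aboveD[OF _ h, of "Suc (deg R h)"] by (metis lessI)
  then show ?thesis
    using a unfolding nilpotents_def by (auto intro!: exI[of _ "Suc (deg R h)"])
qed

section \<open>Contraction of maximal left ideals and the prime radical\<close>

lemma additive_subgroup_contains_poly:
  assumes "additive_subgroup M P" and p: "p \<in> carrier P" and "\<And>n. monom P (coeff P p n) n \<in> M"
  shows "p \<in> M"
proof -
  interpret M: additive_subgroup M P by fact
  have "(\<Oplus>\<^bsub>P\<^esub>i\<in>A. monom P (coeff P p i) i) \<in> M" if "finite A" for A :: "nat set"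
    using that p
    by (induction A) (auto simp: Pi_def assms(3))
  then show ?thesis
    using up_repr[OF p] by (metis finite_atMost)
qed

text \<open>
  For \<open>S = R[x]\<close> the set below is \<open>{r. r S \<subseteq> M}\<close>, the contraction to \<open>R\<close> of the annihilator of
  the simple module \<open>S / M\<close>.
\<close>

lemma maximal_left_ideal_contraction_prime:
  assumes M: "maximal_left_ideal M P"
  shows "nc_prime_ideal {r \<in> carrier R. \<forall>t \<in> carrier R. \<forall>n. monom P (r \<otimes> t) n \<in> M} R"
    (is "nc_prime_ideal ?I R")
proof -
  interpret M: maximal_left_ideal M P by fact
  have one: "\<one>\<^bsub>P\<^esub> \<notin> M"
    using M.I_l_closed[of "\<one>\<^bsub>P\<^esub>"] M.I_notcarr M.a_subset by fastforce
  have I: "ideal ?I R"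
  proof (rule ideal_if_left_ideal[OF left_idealI[OF R.ring_axioms]])
    fix a x assume a: "a \<in> ?I" and x: "x \<in> carrier R"
    have "monom P (x \<otimes> a \<otimes> t) n \<in> M" if "t \<in> carrier R" for t n
      using M.I_l_closed[of "monom P (a \<otimes> t) n" "monom P x 0"] a x that
        monom_mult[of x "a \<otimes> t" 0 n]
      by (simp add: R.m_assoc del: monom_mult)
    then show "x \<otimes> a \<in> ?I"
      using a x by auto
    \<comment> \<open>The factor \<open>x\<close> is absorbed into the arbitrary \<open>t\<close>;
      this is what the quantifier over \<open>t\<close> is for.\<close>
    show "a \<otimes> x \<in> ?I"
      using a x by (auto simp: R.m_assoc simp del: monom_mult)
  next
    show "a \<oplus> b \<in> ?I" if "a \<in> ?I" "b \<in> ?I" for a b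
      using that by (auto simp: R.l_distr)
  qed auto
  \<comment> \<open>Taking \<open>t = \<one>\<close> puts every monomial of \<open>p\<close> into
    \<open>M\<close>.\<close>
  have polys: "p \<in> M" if "p \<in> polys_over R ?I" for p
  proof (rule additive_subgroup_contains_poly[OF M.is_additive_subgroup])
    fix n
    have "coeff P p n \<in> ?I"
      using that by (simp add: polys_over_iff)
    then have "monom P (coeff P p n \<otimes> \<one>) n \<in> M"
      by blast
    then show "monom P (coeff P p n) n \<in> M"
      using that by (simp add: polys_over_iff)
  qed (use that in \<open>simp add: polys_over_iff\<close>)
  show ?thesis
  proof (intro nc_prime_ideal.intro nc_prime_ideal_axioms.intro I)
    have "\<one> \<notin> ?I"
      using one monom_one by (metis (mono_tags, lifting) R.l_one R.one_closed mem_Collect_eq)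
    then show "carrier R \<noteq> ?I"
      by blast
  next
    fix A B assume A: "ideal A R" and B: "ideal B R" and AB: "ideal_prod R A B \<subseteq> ?I"
    interpret A: ideal A R by fact
    interpret B: ideal B R by fact
    have Bx: "left_ideal (polys_over R B) P"
      by (rule P.ideal_left_ideal[OF polys_over_ideal[OF B]])
    show "A \<subseteq> ?I \<or> B \<subseteq> ?I"
    proof (rule disjCI)
      assume "\<not> B \<subseteq> ?I"
      then obtain b t n where b: "b \<in> B" "t \<in> carrier R" "monom P (b \<otimes> t) n \<notin> M"
        using B.a_subset by blast
      have bB: "monom P (b \<otimes> t) n \<in> polys_over R B"
        using b(2) B.I_r_closed[OF b(1,2)] B.Icarr[OF b(1)] by (simp add: polys_over_iff del: monom_mult)
      let ?K = "M <+>\<^bsub>P\<^esub> polys_over R B"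
      have K: "left_ideal ?K P"
        by (rule P.set_add_left_ideal[OF M.left_ideal_axioms Bx])
      have K_iff: "x \<in> ?K \<longleftrightarrow> (\<exists>m\<in>M. \<exists>p\<in>polys_over R B. x = m \<oplus>\<^bsub>P\<^esub> p)" for x
        unfolding set_add_def' by blast
      have "\<zero>\<^bsub>P\<^esub> \<in> polys_over R B"
        using Bx by (simp add: left_ideal_def additive_subgroup.zero_closed)
      then have "M \<subseteq> ?K"
        unfolding K_iff subset_iff by (metis M.a_Hcarr P.r_zero)
      moreover have "polys_over R B \<subseteq> ?K"
        unfolding K_iff subset_iff by (metis M.zero_closed P.l_zero polys_over_iff)
      moreover have "?K \<subseteq> carrier P"
        using K left_ideal.axioms(1) additive_subgroup.a_subset by blast
      ultimately have "?K = carrier P"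
        using M.I_maximal[OF K] b bB by blast
      then obtain m \<beta> where m: "m \<in> M" and \<beta>: "\<beta> \<in> polys_over R B" and one_eq: "\<one>\<^bsub>P\<^esub> = m \<oplus>\<^bsub>P\<^esub> \<beta>"
        using K_iff UP_one_closed by blast
      show "A \<subseteq> ?I"
      proof
        fix a assume a: "a \<in> A"
        have "monom P (a \<otimes> t) n \<in> M" if t: "t \<in> carrier R" for t n
        proof -
          define \<alpha> where "\<alpha> = monom P (a \<otimes> t) n"
          have \<alpha>: "\<alpha> \<in> polys_over R A"
            using t A.I_r_closed[OF a t] A.Icarr[OF a] by (simp add: \<alpha>_def polys_over_iff del: monom_mult)
          have "coeff P (\<alpha> \<otimes>\<^bsub>P\<^esub> \<beta>) k \<in> ?I" for k
          proof -
            have "(\<Oplus>i\<in>{..k}. coeff P \<alpha> i \<otimes> coeff P \<beta> (k - i)) \<in> ?I"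
              using \<alpha> \<beta> AB
              by (intro ideal.finsum_mem[OF I]) (auto simp: polys_over_iff intro: ideal_prod.prod)
            then show ?thesis
              using \<alpha> \<beta> by (simp add: polys_over_iff)
          qed
          then have "\<alpha> \<otimes>\<^bsub>P\<^esub> \<beta> \<in> M"
            using \<alpha> \<beta> by (intro polys) (simp add: polys_over_iff)
          moreover have "\<alpha> \<otimes>\<^bsub>P\<^esub> m \<in> M"
            using m \<alpha> by (intro M.I_l_closed) (simp_all add: polys_over_iff)
          moreover have "\<alpha> = \<alpha> \<otimes>\<^bsub>P\<^esub> m \<oplus>\<^bsub>P\<^esub> \<alpha> \<otimes>\<^bsub>P\<^esub> \<beta>"
            using P.r_distr[of m \<beta> \<alpha>] \<alpha> \<beta> m P.r_one[of \<alpha>] by (simp add: polys_over_iff one_eq[symmetric])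
          ultimately show ?thesis
            unfolding \<alpha>_def[symmetric] by (metis M.a_closed)
        qed
        then show "a \<in> ?I"
          using a by auto
      qed
    qed
  qed
qed

text \<open>The prime radical lies in the prime contraction of every maximal left ideal
  \<open>M\<close>; with \<open>t = \<one>\<close>, all monomials of \<open>p\<close> are in
  \<open>M\<close>.\<close>

lemma polys_over_prime_radical_subset: "polys_over R (prime_radical R) \<subseteq> jacobson_radical P"
proof
  fix p assume p: "p \<in> polys_over R (prime_radical R)"
  have "p \<in> M" if M: "maximal_left_ideal M P" for M
  proof (rule additive_subgroup_contains_poly)
    show "additive_subgroup M P"
      using M by (simp add: maximal_left_ideal_def left_ideal_def)
    fix n
    have "coeff P p n \<in> prime_radical R"
      using p by (simp add: polys_over_iff)
    then have "monom P (coeff P p n \<otimes> \<one>) n \<in> M"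
      using maximal_left_ideal_contraction_prime[OF M] unfolding prime_radical_def by blast
    then show "monom P (coeff P p n) n \<in> M"
      using p by (simp add: polys_over_iff)
  qed (use p in \<open>simp add: polys_over_iff\<close>)
  then show "p \<in> jacobson_radical P"
    using p by (simp add: jacobson_radical_def polys_over_iff)
qed

text \<open>A detour through \<open>R[x]\<close>: constants from the prime radical lie in the
  Jacobson radical of \<open>R[x]\<close>, and such constants are nilpotent.\<close>

lemma prime_radical_subset_nilpotents: "prime_radical R \<subseteq> nilpotents R"
proof
  fix a assume a: "a \<in> prime_radical R"
  then have "a \<in> carrier R"
    by (simp add: prime_radical_def)
  then have "monom P a 0 \<in> polys_over R (prime_radical R)"
    using a additive_subgroup.zero_closed[OF ideal.axioms(1)[OF R.prime_radical_ideal]]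
    by (simp add: polys_over_iff)
  then show "a \<in> nilpotents R"
    using polys_over_prime_radical_subset \<open>a \<in> carrier R\<close>
    by (blast intro: const_in_jacobson_radical_imp_nilpotent)
qed

section \<open>Nilpotent constants and the two equivalences\<close>

lemma const_nilpotent_in_J_sharp:
  assumes "a \<in> nilpotents R"
  shows "monom P a 0 \<in> J_sharp P"
proof -
  obtain n :: nat where a: "a \<in> carrier R" and n: "n \<ge> 1" "a [^] n = \<zero>"
    using assms by (auto simp: nilpotents_def)
  have "monom P a 0 [^]\<^bsub>P\<^esub> k = monom P (a [^] k) 0" for k :: nat
    by (induction k) (use a monom_mult[of _ a 0 0] in simp_all)
  then have "monom P a 0 \<in> nilpotents P"
    using a n by (auto simp: nilpotents_def)
  then show ?thesis
    using P.nilpotents_subset_J_sharp by blast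
qed

text \<open>Forward, the coefficient ideal of the prime radical lies in the Jacobson radical, hence
  in \<open>J_sharp P\<close>, which lies in that coefficient ideal again. Backward, nilpotent
  elements are tested as constant polynomials.\<close>

lemma two_primal_iff: "two_primal R \<longleftrightarrow> J_sharp P = polys_over R (prime_radical R)"
proof
  assume "two_primal R"
  then show "J_sharp P = polys_over R (prime_radical R)"
    using J_sharp_subset_polys_over[OF R.two_primal_imp_completely_semiprime]
      polys_over_prime_radical_subset P.jacobson_radical_subset_J_sharp by blast
next
  assume J: "J_sharp P = polys_over R (prime_radical R)"
  have "a \<in> prime_radical R" if a: "a \<in> nilpotents R" for a
  proof -
    have "coeff P (monom P a 0) 0 \<in> prime_radical R"
      using const_nilpotent_in_J_sharp[OF a] J by (simp add: polys_over_iff)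
    then show ?thesis
      using a by (simp add: nilpotents_def)
  qed
  then show "two_primal R"
    using prime_radical_subset_nilpotents by (auto simp: two_primal_def)
qed

lemma reduced_iff: "reduced_ring R \<longleftrightarrow> J_sharp P = {\<zero>\<^bsub>P\<^esub>}"
proof
  assume "reduced_ring R"
  then have "J_sharp P \<subseteq> polys_over R {\<zero>}"
    by (intro J_sharp_subset_polys_over) (simp add: R.reduced_ring_iff)
  moreover have "polys_over R {\<zero>} \<subseteq> {\<zero>\<^bsub>P\<^esub>}"
    by (auto simp: polys_over_iff intro: up_eqI)
  ultimately show "J_sharp P = {\<zero>\<^bsub>P\<^esub>}"
    using P.zero_in_jacobson_radical P.jacobson_radical_subset_J_sharp by blast
next
  assume J: "J_sharp P = {\<zero>\<^bsub>P\<^esub>}"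
  show "reduced_ring R"
    unfolding reduced_ring_def
  proof
    fix a assume a: "a \<in> nilpotents R"
    then have "monom P a 0 = \<zero>\<^bsub>P\<^esub>"
      using const_nilpotent_in_J_sharp J by blast
    then show "a = \<zero>"
      using a coeff_monom[of a 0 0] coeff_zero[of 0] by (simp add: nilpotents_def)
  qed
qed

end

theorem theorem3p17:
  fixes R :: "('a, 'b) ring_scheme"
  assumes "ring R"
  shows "(two_primal R \<longleftrightarrow> J_sharp (UP R) = polys_over R (prime_radical R))
       \<and> (reduced_ring R \<longleftrightarrow> J_sharp (UP R) = {\<zero>\<^bsub>UP R\<^esub>})"
proof -
  interpret UP_ring R "UP R"
    using assms by (intro UP_ring.intro)
  show ?thesis
    using two_primal_iff reduced_iff by blast
qed

end
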